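(* Let $(X,d)$ be a complete and regular semimetric space and let $\varphi\colon\mathbb{R}_+\to\mathbb{R}_+$ be a comparison function. If $(T_n)_{n\in\mathbb{N}}$ is a sequence of $\varphi$-contractions $T_n\colon X\to X$ converging pointwise to a $\varphi$-contraction $T_0\colon X\to X$ (that is, $d(T_nx,T_0x)\to 0$ for every $x\in X$), then the sequence of the (unique) fixed points of the mappings $T_n$ converges to the unique fixed point of $T_0$.
   Context: $\mathbb{R}_+=[0,\infty)$ and $\overline{\mathbb{R}}_+=[0,\infty]$. A semimetric space is a pair $(X,d)$ where $X$ is a nonempty set and $d\colon X\times X\to\mathbb{R}_+$ is symmetric and satisfies $d(x,y)=0$ if and only if $x=y$ (no triangle inequality is assumed). A sequence $(x_n)$ converges to $x\in X$ if $d(x_n,x)\to 0$; it is Cauchy if for every $\varepsilon>0$ there is $N$ such that $d(x_n,x_m)<\varepsilon$ for all $n,m\ge N$. The space is complete if every Cauchy sequence converges to some point of $X$. The basic triangle function of $(X,d)$ is $\Phi_d\colon\overline{\mathbb{R}}_+^2\to\overline{\mathbb{R}}_+$, $\Phi_d(u,v):=\sup\{d(x,y)\mid x,y\in X,\ \exists p\in X:\ d(p,x)\le u,\ d(p,y)\le v\}$. The semimetric space $(X,d)$ is called regular if $\Phi_d$ is continuous at the origin $(0,0)$ (note $\Phi_d(0,0)=0$). A comparison function is a monotone increasing (i.e. nondecreasing) function $\varphi\colon\mathbb{R}_+\to\mathbb{R}_+$ such that $\lim_{n\to\infty}\varphi^n(t)=0$ for all $t\ge 0$, where $\varphi^n$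 is the $n$-th iterate. Given a comparison function $\varphi$, a mapping $T\colon X\to X$ is a $\varphi$-contraction if $d(Tx,Ty)\le\varphi(d(x,y))$ for all $x,y\in X$. In a complete regular semimetric space every $\varphi$-contraction has a unique fixed point, so the fixed points mentioned in the claim exist and are unique. *)

theory Defs
  imports Complex_Main "HOL-Library.Extended_Nonnegative_Real" "HOL-Library.FuncSet"
begin

locale semimetric_space =
  fixes X :: "'a set" and d :: "'a \<Rightarrow> 'a \<Rightarrow> real"
  assumes nonempty: "X \<noteq> {}"
    and nonneg: "\<And>x y. x \<in> X \<Longrightarrow> y \<in> X \<Longrightarrow> 0 \<le> d x y"
    and commute: "\<And>x y. x \<in> X \<Longrightarrow> y \<in> X \<Longrightarrow> d x y = d y x"
    and zero: "\<And>x y. x \<in> X \<Longrightarrow> y \<in> X \<Longrightarrow> d x y = 0 \<longleftrightarrow> x = y"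

definition converges_to :: "'a set \<Rightarrow> ('a \<Rightarrow> 'a \<Rightarrow> real) \<Rightarrow> (nat \<Rightarrow> 'a) \<Rightarrow> 'a \<Rightarrow> bool" where
  "converges_to X d s x \<longleftrightarrow> range s \<subseteq> X \<and> x \<in> X \<and> (\<lambda>n. d (s n) x) \<longlonglongrightarrow> 0"

definition cauchy_sequence :: "'a set \<Rightarrow> ('a \<Rightarrow> 'a \<Rightarrow> real) \<Rightarrow> (nat \<Rightarrow> 'a) \<Rightarrow> bool" where
  "cauchy_sequence X d s \<longleftrightarrow>
     range s \<subseteq> X \<and> (\<forall>\<epsilon>>0. \<exists>N. \<forall>n\<ge>N. \<forall>m\<ge>N. d (s n) (s m) < \<epsilon>)"

definition complete_semimetric :: "'a set \<Rightarrow> ('a \<Rightarrow> 'a \<Rightarrow> real) \<Rightarrow> bool" where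
  "complete_semimetric X d \<longleftrightarrow>
     (\<forall>s. cauchy_sequence X d s \<longrightarrow> (\<exists>x. converges_to X d s x))"

(* Both arguments and the value range over [0, \<infinity>], represented by ennreal;
   the supremum may be infinite. *)
definition basic_triangle_function ::
    "'a set \<Rightarrow> ('a \<Rightarrow> 'a \<Rightarrow> real) \<Rightarrow> ennreal \<Rightarrow> ennreal \<Rightarrow> ennreal" where
  "basic_triangle_function X d u v =
     Sup {ennreal (d x y) | x y. x \<in> X \<and> y \<in> X \<and>
            (\<exists>p\<in>X. ennreal (d p x) \<le> u \<and> ennreal (d p y) \<le> v)}"

(* Joint continuity at the origin, in the product topology of [0, \<infinity>] x [0, \<infinity>]. *)
definition regular_semimetric :: "'a set \<Rightarrow> ('a \<Rightarrow> 'a \<Rightarrow> real) \<Rightarrow> bool" where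
  "regular_semimetric X d \<longleftrightarrow>
     isCont (\<lambda>(u, v). basic_triangle_function X d u v) (0, 0)"

(* Functions on [0, \<infinity>) are functions on the reals of which only the values on {0..} matter. *)
definition comparison_function :: "(real \<Rightarrow> real) \<Rightarrow> bool" where
  "comparison_function \<phi> \<longleftrightarrow>
     \<phi> \<in> {0..} \<rightarrow> {0..} \<and> mono_on {0..} \<phi> \<and> (\<forall>t\<ge>0. (\<lambda>n. (\<phi> ^^ n) t) \<longlonglongrightarrow> 0)"

definition phi_contraction ::
    "'a set \<Rightarrow> ('a \<Rightarrow> 'a \<Rightarrow> real) \<Rightarrow> (real \<Rightarrow> real) \<Rightarrow> ('a \<Rightarrow> 'a) \<Rightarrow> bool" where
  "phi_contraction X d \<phi> T \<longleftrightarrow>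
     T \<in> X \<rightarrow> X \<and> (\<forall>x\<in>X. \<forall>y\<in>X. d (T x) (T y) \<le> \<phi> (d x y))"

(* Meaningful only for maps with exactly one fixed point in X. *)
definition fixed_point :: "'a set \<Rightarrow> ('a \<Rightarrow> 'a) \<Rightarrow> 'a" where
  "fixed_point X T = (THE x. x \<in> X \<and> T x = x)"

end

theory Submission
  imports Defs
begin

text \<open>
  Regularity is a uniform weak triangle inequality: two points are close as soon as both are close
  to a common third point. It is not quantitative enough to sum the successive steps of an orbit.
  Instead, given \<open>\<epsilon>\<close>, let \<open>\<delta>\<close> be the corresponding modulus and pick \<open>m\<close> with
  \<open>\<phi>\<^sup>m(\<epsilon>) \<le> \<delta>\<close>. If \<open>T\<^sup>m\<close> moves \<open>x\<close> by at most \<open>\<delta>\<close>, then \<open>T\<^sup>m\<close> maps the closed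
  \<open>\<epsilon>\<close>-ball about \<open>x\<close> to itself: it contracts the ball into the \<open>\<delta>\<close>-ball about \<open>T\<^sup>m x\<close>, and
  \<open>x\<close> also lies in that ball. So if the first \<open>m\<close> iterates of \<open>x\<close> stay within \<open>\<delta>\<close> of \<open>x\<close>, the
  whole orbit stays within \<open>\<epsilon>\<close>. This is \<open>orbit_trapping\<close>. The point is that \<open>\<delta>\<close> and \<open>m\<close>
  depend only on \<open>\<epsilon>\<close>, \<open>\<phi>\<close> and the space, and not on \<open>T\<close> or \<open>x\<close>.

  The lemma serves twice. Applied to one contraction at a late point of an orbit, where the next
  \<open>m\<close> steps are small because \<open>d(T\<^sup>k x, T\<^sup>k\<^sup>+\<^sup>j x) \<le> \<phi>\<^sup>k(d(x, T\<^sup>j x))\<close>, it shows that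
  orbits are Cauchy, which gives the fixed points. Applied to all \<open>T\<^sub>n\<close> at the fixed point
  \<open>x\<^sub>0\<close> of \<open>T\<^sub>0\<close>, it gives the convergence: pointwise convergence and regularity make the first
  \<open>m\<close> iterates of \<open>x\<^sub>0\<close> under \<open>T\<^sub>n\<close> stay near \<open>x\<^sub>0\<close> once \<open>n\<close> is large, so the whole
  orbit does, and hence so does its limit, the fixed point of \<open>T\<^sub>n\<close>.
\<close>

section \<open>Comparison functions and contractions\<close>

lemma funpow_funpow: "(f ^^ m) ((f ^^ n) x) = (f ^^ (m + n)) x"
  by (simp add: funpow_add)

lemma comparison_nonneg:
  assumes "comparison_function \<phi>" "0 \<le> t"
  shows "0 \<le> \<phi> t"
  using assms by (auto simp: comparison_function_def)

lemma comparison_mono: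
  assumes "comparison_function \<phi>" "0 \<le> s" "s \<le> t"
  shows "\<phi> s \<le> \<phi> t"
  using assms by (auto simp: comparison_function_def intro: mono_onD)

lemma comparison_iterate_nonneg:
  assumes "comparison_function \<phi>" "0 \<le> t"
  shows "0 \<le> (\<phi> ^^ n) t"
  by (induction n) (use assms comparison_nonneg in auto)

lemma comparison_iterate_mono:
  assumes "comparison_function \<phi>" "0 \<le> s" "s \<le> t"
  shows "(\<phi> ^^ n) s \<le> (\<phi> ^^ n) t"
  by (induction n) (use assms comparison_mono comparison_iterate_nonneg in auto)

lemma comparison_iterate_tendsto:
  assumes "comparison_function \<phi>" "0 \<le> t"
  shows "(\<lambda>n. (\<phi> ^^ n) t) \<longlonglongrightarrow> 0"
  using assms by (auto simp: comparison_function_def)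

text \<open>
  If \<open>t \<le> \<phi> t\<close>, monotonicity propagates the inequality along the iterates, which then stay
  above \<open>\<phi> t\<close> while tending to \<open>0\<close>. Bounding by \<open>\<phi> t\<close> rather than by \<open>t\<close> also settles
  \<open>\<phi> 0 = 0\<close>.
\<close>

lemma comparison_ge_imp_nonpos:
  assumes \<phi>: "comparison_function \<phi>" and t: "0 \<le> t" "t \<le> \<phi> t"
  shows "\<phi> t \<le> 0"
proof -
  have ge: "t \<le> (\<phi> ^^ n) t" for n
  proof (induction n)
    case (Suc n)
    then show ?case using comparison_mono[OF \<phi> t(1) Suc] t(2) by simp
  qed simp
  have "\<phi> t \<le> (\<phi> ^^ Suc n) t" for n
    using comparison_mono[OF \<phi> t(1) ge] by simp
  moreover have "(\<lambda>n. (\<phi> ^^ Suc n) t) \<longlonglongrightarrow> 0"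
    using comparison_iterate_tendsto[OF \<phi> t(1)] by (rule LIMSEQ_Suc)
  ultimately show ?thesis
    by (intro LIMSEQ_le_const) auto
qed

lemma comparison_le:
  assumes "comparison_function \<phi>" "0 \<le> t"
  shows "\<phi> t \<le> t"
  using comparison_ge_imp_nonpos[OF assms] assms(2) by linarith

lemma phi_contraction_closed:
  assumes "phi_contraction X d \<phi> T" "x \<in> X"
  shows "T x \<in> X"
  using assms by (auto simp: phi_contraction_def)

lemma phi_contraction_iterate_closed:
  assumes "phi_contraction X d \<phi> T" "x \<in> X"
  shows "(T ^^ n) x \<in> X"
  by (induction n) (use assms phi_contraction_closed in auto)

context semimetric_space
begin

lemma phi_contraction_iterate:
  assumes \<phi>: "comparison_function \<phi>" and T: "phi_contraction X d \<phi> T"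
    and X: "x \<in> X" "y \<in> X"
  shows "d ((T ^^ n) x) ((T ^^ n) y) \<le> (\<phi> ^^ n) (d x y)"
proof (induction n)
  case (Suc n)
  have X': "(T ^^ n) x \<in> X" "(T ^^ n) y \<in> X"
    using phi_contraction_iterate_closed[OF T] X by auto
  have "d ((T ^^ Suc n) x) ((T ^^ Suc n) y) \<le> \<phi> (d ((T ^^ n) x) ((T ^^ n) y))"
    using T X' by (simp add: phi_contraction_def)
  also have "\<dots> \<le> \<phi> ((\<phi> ^^ n) (d x y))"
    using comparison_mono[OF \<phi> nonneg[OF X'] Suc] .
  finally show ?case by simp
qed simp

lemma phi_contraction_nonexpansive:
  assumes "comparison_function \<phi>" "phi_contraction X d \<phi> T" "x \<in> X" "y \<in> X"
  shows "d (T x) (T y) \<le> d x y"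
  using phi_contraction_iterate[OF assms, of 1] comparison_le[OF assms(1) nonneg[OF assms(3,4)]]
  by simp

lemma phi_contraction_iterate_tendsto:
  assumes \<phi>: "comparison_function \<phi>" and T: "phi_contraction X d \<phi> T"
    and X: "x \<in> X" "y \<in> X"
  shows "(\<lambda>n. d ((T ^^ n) x) ((T ^^ n) y)) \<longlonglongrightarrow> 0"
  by (rule tendsto_sandwich[OF _ _ tendsto_const comparison_iterate_tendsto[OF \<phi> nonneg[OF X]]])
    (auto intro!: always_eventually nonneg phi_contraction_iterate_closed[OF T] X
      phi_contraction_iterate[OF \<phi> T])

section \<open>Regularity as a weak triangle inequality\<close>

text \<open>
  This is the form in which regularity is used. Since \<open>d p x = 0\<close> forces \<open>p = x\<close>, the basic
  triangle function vanishes at the origin, so continuity makes it small at \<open>(\<delta>, \<delta>)\<close> for small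
  \<open>\<delta>\<close>.
\<close>

lemma regular_modulus:
  assumes reg: "regular_semimetric X d" and \<epsilon>: "0 < \<epsilon>"
  obtains \<delta> where "0 < \<delta>"
    "\<And>p x y. \<lbrakk>p \<in> X; x \<in> X; y \<in> X; d p x \<le> \<delta>; d p y \<le> \<delta>\<rbrakk> \<Longrightarrow> d x y \<le> \<epsilon>"
proof -
  let ?\<Phi> = "basic_triangle_function X d"
  let ?s = "\<lambda>n::nat. ennreal (inverse (real (Suc n)))"
  have degenerate: "d x y = 0" if "x \<in> X" "y \<in> X" "p \<in> X" "ennreal (d p x) \<le> 0" "ennreal (d p y) \<le> 0"
    for x y p
  proof -
    have "d p x = 0" "d p y = 0"
      using that nonneg by (auto simp: ennreal_eq_0_iff intro: antisym)
    then show ?thesis using that zero by blast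
  qed
  have "?\<Phi> 0 0 \<le> 0"
    unfolding basic_triangle_function_def
  proof (rule Sup_least, clarify)
    fix x y p assume "x \<in> X" "y \<in> X" "p \<in> X" "ennreal (d p x) \<le> 0" "ennreal (d p y) \<le> 0"
    from degenerate[OF this] show "ennreal (d x y) \<le> 0" by simp
  qed
  then have origin: "?\<Phi> 0 0 = 0" by simp
  have "?s \<longlonglongrightarrow> ennreal 0"
    by (intro tendsto_ennrealI LIMSEQ_inverse_real_of_nat)
  then have "(\<lambda>n. (?s n, ?s n)) \<longlonglongrightarrow> (0, 0)"
    by (intro tendsto_Pair) auto
  with reg have "(\<lambda>n. ?\<Phi> (?s n) (?s n)) \<longlonglongrightarrow> ?\<Phi> 0 0"
    unfolding regular_semimetric_def by (auto dest: isCont_tendsto_compose)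
  then have "eventually (\<lambda>n. ?\<Phi> (?s n) (?s n) < ennreal \<epsilon>) sequentially"
    using \<epsilon> by (intro order_tendstoD) (auto simp: origin)
  then obtain n where n: "?\<Phi> (?s n) (?s n) < ennreal \<epsilon>"
    by (auto simp: eventually_sequentially)
  show thesis
  proof (rule that)
    show "0 < inverse (real (Suc n))" by simp
    fix p x y
    assume X: "p \<in> X" "x \<in> X" "y \<in> X"
      and le: "d p x \<le> inverse (real (Suc n))" "d p y \<le> inverse (real (Suc n))"
    have "ennreal (d x y) \<le> ?\<Phi> (?s n) (?s n)"
      unfolding basic_triangle_function_def
      using X le by (intro Sup_upper) (blast intro: ennreal_leI)
    with n have "ennreal (d x y) \<le> ennreal \<epsilon>" by simp
    then show "d x y \<le> \<epsilon>" using \<epsilon> by (simp add: ennreal_le_iff)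
  qed
qed

lemma regular_tendsto:
  assumes reg: "regular_semimetric X d"
    and X: "\<And>n. p n \<in> X" "\<And>n. x n \<in> X" "\<And>n. y n \<in> X"
    and lim: "(\<lambda>n. d (p n) (x n)) \<longlonglongrightarrow> 0" "(\<lambda>n. d (p n) (y n)) \<longlonglongrightarrow> 0"
  shows "(\<lambda>n::nat. d (x n) (y n)) \<longlonglongrightarrow> 0"
proof (rule LIMSEQ_I)
  fix r :: real assume "0 < r"
  then obtain \<delta> where \<delta>: "0 < \<delta>"
    "\<And>p x y. \<lbrakk>p \<in> X; x \<in> X; y \<in> X; d p x \<le> \<delta>; d p y \<le> \<delta>\<rbrakk> \<Longrightarrow> d x y \<le> r / 2"
    using regular_modulus[OF reg, of "r / 2"] by auto
  have "eventually (\<lambda>n. d (p n) (x n) < \<delta> \<and> d (p n) (y n) < \<delta>) sequentially"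
    using lim \<delta>(1) by (intro eventually_conj order_tendstoD)
  then obtain N where N: "\<And>n. N \<le> n \<Longrightarrow> d (p n) (x n) < \<delta> \<and> d (p n) (y n) < \<delta>"
    by (auto simp: eventually_sequentially)
  have "norm (d (x n) (y n) - 0) < r" if "N \<le> n" for n
    using \<delta>(2)[OF X, of n n n] N[OF that] nonneg[OF X(2,3), of n n] \<open>0 < r\<close> by auto
  then show "\<exists>N. \<forall>n\<ge>N. norm (d (x n) (y n) - 0) < r" by blast
qed

section \<open>Orbit trapping and the fixed point theorem\<close>

text \<open>
  The number \<open>m\<close> is such that \<open>\<phi>\<^sup>m(\<epsilon>) \<le> \<delta>\<close>, so \<open>T\<^sup>m\<close> maps the closed \<open>\<epsilon>\<close>-ball about \<open>x\<close>
  to itself; an iterate of order \<open>j > m\<close> is handled through the one of order \<open>j - m\<close>. Note the order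
  of quantifiers: \<open>\<delta>\<close> and \<open>m\<close> come before the map, which is what makes the estimate usable for a
  whole sequence of contractions.
\<close>

lemma orbit_trapping:
  assumes reg: "regular_semimetric X d" and \<phi>: "comparison_function \<phi>" and \<epsilon>: "0 < \<epsilon>"
  obtains \<delta> m where "0 < \<delta>"
    "\<And>T x j. \<lbrakk>phi_contraction X d \<phi> T; x \<in> X; \<And>i. i \<le> m \<Longrightarrow> d x ((T ^^ i) x) \<le> \<delta>\<rbrakk>
      \<Longrightarrow> d x ((T ^^ j) x) \<le> \<epsilon>"
proof -
  obtain \<delta>' where \<delta>': "0 < \<delta>'"
    "\<And>p x y. \<lbrakk>p \<in> X; x \<in> X; y \<in> X; d p x \<le> \<delta>'; d p y \<le> \<delta>'\<rbrakk> \<Longrightarrow> d x y \<le> \<epsilon>"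
    using regular_modulus[OF reg \<epsilon>] by blast
  define \<delta> where "\<delta> = min \<delta>' \<epsilon>"
  have \<delta>: "0 < \<delta>" "\<delta> \<le> \<delta>'" "\<delta> \<le> \<epsilon>" using \<delta>' \<epsilon> by (auto simp: \<delta>_def)
  have "eventually (\<lambda>n. (\<phi> ^^ n) \<epsilon> < \<delta>) sequentially"
    using comparison_iterate_tendsto[OF \<phi>, of \<epsilon>] \<epsilon> \<delta>(1) by (intro order_tendstoD) auto
  \<comment> \<open>The induction below needs \<open>j - m < j\<close>, hence a positive \<open>m\<close>.\<close>
  then have "eventually (\<lambda>n. (\<phi> ^^ n) \<epsilon> < \<delta> \<and> 0 < n) sequentially"
    by (intro eventually_conj eventually_gt_at_top)
  then obtain m where m: "(\<phi> ^^ m) \<epsilon> < \<delta>" "0 < m"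
    by (auto simp: eventually_sequentially)
  show thesis
  proof (rule that[OF \<delta>(1)])
    fix T x j
    assume T: "phi_contraction X d \<phi> T" and x: "x \<in> X"
      and init: "\<And>i. i \<le> m \<Longrightarrow> d x ((T ^^ i) x) \<le> \<delta>"
    note X = phi_contraction_iterate_closed[OF T x]
    show "d x ((T ^^ j) x) \<le> \<epsilon>"
    proof (induction j rule: less_induct)
      case (less j)
      show ?case
      proof (cases "j \<le> m")
        case True
        then show ?thesis using init \<delta>(3) by (meson order_trans)
      next
        case False
        define y where "y = (T ^^ (j - m)) x"
        have y: "y \<in> X" "d x y \<le> \<epsilon>"
          using X less[of "j - m"] False m(2) by (auto simp: y_def)
        have j: "(T ^^ j) x = (T ^^ m) y"
          using False by (simp add: y_def funpow_funpow)
        have "d ((T ^^ m) x) ((T ^^ m) y) \<le> (\<phi> ^^ m) (d x y)"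
          by (rule phi_contraction_iterate[OF \<phi> T x y(1)])
        also have "\<dots> \<le> (\<phi> ^^ m) \<epsilon>"
          by (rule comparison_iterate_mono[OF \<phi> nonneg[OF x y(1)] y(2)])
        also have "\<dots> \<le> \<delta>'" using m(1) \<delta>(2) by simp
        finally have "d ((T ^^ m) x) ((T ^^ j) x) \<le> \<delta>'" by (simp add: j)
        moreover have "d ((T ^^ m) x) x \<le> \<delta>'"
          using init[of m] \<delta>(2) commute[OF x X, of m] by simp
        ultimately show ?thesis using \<delta>'(2)[OF X x X] by blast
      qed
    qed
  qed
qed

text \<open>
  For each \<open>j\<close> the distances \<open>d(T\<^sup>k x, T\<^sup>k\<^sup>+\<^sup>j x)\<close> tend to \<open>0\<close> with \<open>k\<close>, without any
  triangle inequality. Orbit trapping needs this for finitely many \<open>j\<close> only, and then bounds the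
  distance of \<open>T\<^sup>N x\<close> to its whole forward orbit; regularity turns this into the Cauchy property.
\<close>

lemma phi_contraction_orbit_cauchy:
  assumes reg: "regular_semimetric X d" and \<phi>: "comparison_function \<phi>"
    and T: "phi_contraction X d \<phi> T" and x: "x \<in> X"
  shows "cauchy_sequence X d (\<lambda>n. (T ^^ n) x)"
  unfolding cauchy_sequence_def
proof (intro conjI allI impI)
  note X = phi_contraction_iterate_closed[OF T x]
  show "range (\<lambda>n. (T ^^ n) x) \<subseteq> X" using X by blast
  fix r :: real assume "0 < r"
  then obtain \<epsilon> where \<epsilon>: "0 < \<epsilon>"
    "\<And>p x y. \<lbrakk>p \<in> X; x \<in> X; y \<in> X; d p x \<le> \<epsilon>; d p y \<le> \<epsilon>\<rbrakk> \<Longrightarrow> d x y \<le> r / 2"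
    using regular_modulus[OF reg, of "r / 2"] by auto
  obtain \<delta> m where \<delta>: "0 < \<delta>"
    and trap: "\<And>T x j. \<lbrakk>phi_contraction X d \<phi> T; x \<in> X; \<And>i. i \<le> m \<Longrightarrow> d x ((T ^^ i) x) \<le> \<delta>\<rbrakk>
      \<Longrightarrow> d x ((T ^^ j) x) \<le> \<epsilon>"
    using orbit_trapping[OF reg \<phi> \<epsilon>(1)] by blast
  have shift: "(T ^^ i) ((T ^^ k) x) = (T ^^ k) ((T ^^ i) x)" for i k
    by (simp add: funpow_funpow add.commute)
  have "eventually (\<lambda>k. d ((T ^^ k) x) ((T ^^ k) ((T ^^ i) x)) < \<delta>) sequentially" for i
    using phi_contraction_iterate_tendsto[OF \<phi> T x X] \<delta> by (intro order_tendstoD) auto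
  then have "eventually (\<lambda>k. \<forall>i\<in>{..m}. d ((T ^^ k) x) ((T ^^ k) ((T ^^ i) x)) < \<delta>) sequentially"
    by (intro eventually_ball_finite) auto
  then obtain N where N: "\<And>i. i \<le> m \<Longrightarrow> d ((T ^^ N) x) ((T ^^ N) ((T ^^ i) x)) < \<delta>"
    by (auto simp: eventually_sequentially)
  have "d ((T ^^ N) x) ((T ^^ i) ((T ^^ N) x)) \<le> \<delta>" if "i \<le> m" for i
    using N[OF that] by (simp add: shift)
  then have ball: "d ((T ^^ N) x) ((T ^^ j) ((T ^^ N) x)) \<le> \<epsilon>" for j
    by (rule trap[OF T X])
  have near: "d ((T ^^ N) x) ((T ^^ n) x) \<le> \<epsilon>" if "N \<le> n" for n
    using ball[of "n - N"] that by (simp add: funpow_funpow)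
  have "d ((T ^^ n) x) ((T ^^ k) x) < r" if "N \<le> n" "N \<le> k" for n k
    using \<epsilon>(2)[OF X X X near[OF that(1)] near[OF that(2)]] \<open>0 < r\<close> by simp
  then show "\<exists>N. \<forall>n\<ge>N. \<forall>k\<ge>N. d ((T ^^ n) x) ((T ^^ k) x) < r" by blast
qed

lemma phi_contraction_unique_fixed_point:
  assumes comp: "complete_semimetric X d" and reg: "regular_semimetric X d"
    and \<phi>: "comparison_function \<phi>" and T: "phi_contraction X d \<phi> T"
  shows "\<exists>!x. x \<in> X \<and> T x = x"
proof -
  obtain x where x: "x \<in> X" using nonempty by blast
  note X = phi_contraction_iterate_closed[OF T x]
  obtain z where z: "z \<in> X" "(\<lambda>n. d ((T ^^ n) x) z) \<longlonglongrightarrow> 0"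
    using comp phi_contraction_orbit_cauchy[OF reg \<phi> T x]
    unfolding complete_semimetric_def converges_to_def by blast
  note Tz = phi_contraction_closed[OF T z(1)]
  have "(\<lambda>n. d ((T ^^ Suc n) x) (T z)) \<longlonglongrightarrow> 0"
    by (rule tendsto_sandwich[OF _ _ tendsto_const z(2)])
      (use nonneg[OF X Tz, of "Suc _"] phi_contraction_nonexpansive[OF \<phi> T X z(1)] in auto)
  moreover have "(\<lambda>n. d ((T ^^ Suc n) x) z) \<longlonglongrightarrow> 0"
    using z(2) by (rule LIMSEQ_Suc)
  ultimately have "(\<lambda>n::nat. d (T z) z) \<longlonglongrightarrow> 0"
    by (intro regular_tendsto[OF reg, of "\<lambda>n. (T ^^ Suc n) x" "\<lambda>_. T z" "\<lambda>_. z"])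
      (use X[of "Suc _"] Tz z in auto)
  then have "T z = z"
    using zero[OF Tz z(1)] by (simp add: LIMSEQ_const_iff)
  moreover have "a = b" if "a \<in> X" "T a = a" "b \<in> X" "T b = b" for a b
  proof -
    have "d a b \<le> \<phi> (d a b)"
      using T that by (metis phi_contraction_def)
    then have "d a b \<le> 0"
      using comparison_ge_imp_nonpos[OF \<phi> nonneg[OF that(1,3)]] by simp
    then show ?thesis
      using nonneg[OF that(1,3)] zero[OF that(1,3)] by simp
  qed
  ultimately show ?thesis using z(1) by blast
qed

section \<open>Stability of fixed points under pointwise convergence\<close>

text \<open>
  A fixed number of iterations propagates an error continuously: \<open>T\<^sub>n\<close> is nonexpansive, so
  \<open>T\<^sub>n\<^sup>j\<^sup>+\<^sup>1 z\<close> is at least as close to \<open>T\<^sub>n z\<close> as \<open>T\<^sub>n\<^sup>j z\<close> is to \<open>z\<close>, and regularity absorbs the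
  distance from \<open>T\<^sub>n z\<close> to \<open>z\<close>.
\<close>

lemma iterates_tendsto:
  assumes reg: "regular_semimetric X d" and \<phi>: "comparison_function \<phi>"
    and T: "\<And>n. phi_contraction X d \<phi> (T n)" and z: "z \<in> X"
    and lim: "(\<lambda>n. d (T n z) z) \<longlonglongrightarrow> 0"
  shows "(\<lambda>n. d z ((T n ^^ j) z)) \<longlonglongrightarrow> 0"
proof (induction j)
  case 0
  then show ?case using zero[OF z z] by simp
next
  case (Suc j)
  note X = phi_contraction_iterate_closed[OF T z]
  note Tz = phi_contraction_closed[OF T z]
  have "0 \<le> d (T n z) ((T n ^^ Suc j) z)" for n
    by (rule nonneg[OF Tz X])
  moreover have "d (T n z) ((T n ^^ Suc j) z) \<le> d z ((T n ^^ j) z)" for n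
    using phi_contraction_nonexpansive[OF \<phi> T z X] by simp
  ultimately have "(\<lambda>n. d (T n z) ((T n ^^ Suc j) z)) \<longlonglongrightarrow> 0"
    by (intro tendsto_sandwich[OF _ _ tendsto_const Suc] always_eventually allI)
  with lim show ?case
    by (intro regular_tendsto[OF reg, of "\<lambda>n. T n z" "\<lambda>_. z"])
      (rule Tz X z | assumption)+
qed

lemma fixed_points_tendsto:
  assumes reg: "regular_semimetric X d" and \<phi>: "comparison_function \<phi>"
    and T: "\<And>n. phi_contraction X d \<phi> (T n)" and z: "z \<in> X"
    and lim: "(\<lambda>n. d (T n z) z) \<longlonglongrightarrow> 0"
    and fp: "\<And>n. x n \<in> X" "\<And>n. T n (x n) = x n"
  shows "(\<lambda>n. d (x n) z) \<longlonglongrightarrow> 0"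
proof (rule LIMSEQ_I)
  fix r :: real assume "0 < r"
  then obtain \<epsilon> where \<epsilon>: "0 < \<epsilon>"
    "\<And>p x y. \<lbrakk>p \<in> X; x \<in> X; y \<in> X; d p x \<le> \<epsilon>; d p y \<le> \<epsilon>\<rbrakk> \<Longrightarrow> d x y \<le> r / 2"
    using regular_modulus[OF reg, of "r / 2"] by auto
  obtain \<delta> m where \<delta>: "0 < \<delta>"
    and trap: "\<And>T x j. \<lbrakk>phi_contraction X d \<phi> T; x \<in> X; \<And>i. i \<le> m \<Longrightarrow> d x ((T ^^ i) x) \<le> \<delta>\<rbrakk>
      \<Longrightarrow> d x ((T ^^ j) x) \<le> \<epsilon>"
    using orbit_trapping[OF reg \<phi> \<epsilon>(1)] by blast
  have "eventually (\<lambda>n. \<forall>i\<in>{..m}. d z ((T n ^^ i) z) < \<delta>) sequentially"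
    using iterates_tendsto[OF reg \<phi> T z lim] \<delta>
    by (intro eventually_ball_finite ballI order_tendstoD) auto
  then obtain N where N: "\<And>n i. N \<le> n \<Longrightarrow> i \<le> m \<Longrightarrow> d z ((T n ^^ i) z) < \<delta>"
    by (auto simp: eventually_sequentially)
  have "norm (d (x n) z - 0) < r" if "N \<le> n" for n
  proof -
    note X = phi_contraction_iterate_closed[OF T z]
    have fix_iter: "(T n ^^ k) (x n) = x n" for k
      by (induction k) (use fp(2) in auto)
    \<comment> \<open>Balls need not be closed, so the bound on the orbit of \<open>z\<close> passes to its limit \<open>x n\<close> only
      through one more use of regularity, at a point of the orbit close to \<open>x n\<close>.\<close>
    have "(\<lambda>k. d ((T n ^^ k) z) (x n)) \<longlonglongrightarrow> 0"
      using phi_contraction_iterate_tendsto[OF \<phi> T z fp(1)[of n], of n] by (simp add: fix_iter)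
    then have "eventually (\<lambda>k. d ((T n ^^ k) z) (x n) < \<epsilon>) sequentially"
      using \<epsilon>(1) by (intro order_tendstoD)
    then obtain k where k: "d ((T n ^^ k) z) (x n) < \<epsilon>"
      by (auto simp: eventually_sequentially)
    have "d z ((T n ^^ k) z) \<le> \<epsilon>"
      using N[OF that] by (intro trap[OF T z]) (simp add: less_imp_le)
    then have "d ((T n ^^ k) z) z \<le> \<epsilon>"
      using commute[OF z X] by simp
    with k have "d (x n) z \<le> r / 2"
      by (intro \<epsilon>(2)[OF X fp(1) z]) (rule less_imp_le)
    then show ?thesis using nonneg[OF fp(1) z, of n] \<open>0 < r\<close> by simp
  qed
  then show "\<exists>N. \<forall>n\<ge>N. norm (d (x n) z - 0) < r" by blast
qed

end

lemma fixed_point_properties: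
  assumes "\<exists>!x. x \<in> X \<and> T x = x"
  shows "fixed_point X T \<in> X" "T (fixed_point X T) = fixed_point X T"
  using theI'[OF assms] by (auto simp: fixed_point_def)

theorem theorem2:
  fixes X :: "'a set" and d :: "'a \<Rightarrow> 'a \<Rightarrow> real" and \<phi> :: "real \<Rightarrow> real"
    and T :: "nat \<Rightarrow> 'a \<Rightarrow> 'a" and T0 :: "'a \<Rightarrow> 'a"
  assumes "semimetric_space X d"
    and "complete_semimetric X d"
    and "regular_semimetric X d"
    and "comparison_function \<phi>"
    and "\<And>n. phi_contraction X d \<phi> (T n)"
    and "phi_contraction X d \<phi> T0"
    and "\<And>x. x \<in> X \<Longrightarrow> converges_to X d (\<lambda>n. T n x) (T0 x)"
  shows "(\<forall>n. \<exists>!x. x \<in> X \<and> T n x = x) \<and> (\<exists>!x. x \<in> X \<and> T0 x = x) \<and>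
    converges_to X d (\<lambda>n. fixed_point X (T n)) (fixed_point X T0)"
proof -
  interpret semimetric_space X d by fact
  have ex: "\<exists>!x. x \<in> X \<and> T n x = x" for n
    by (rule phi_contraction_unique_fixed_point[OF assms(2-5)])
  have ex0: "\<exists>!x. x \<in> X \<and> T0 x = x"
    by (rule phi_contraction_unique_fixed_point[OF assms(2-4,6)])
  note fp = fixed_point_properties[OF ex] and fp0 = fixed_point_properties[OF ex0]
  have "(\<lambda>n. d (T n (fixed_point X T0)) (fixed_point X T0)) \<longlonglongrightarrow> 0"
    using assms(7)[OF fp0(1)] by (simp add: converges_to_def fp0(2))
  then have "(\<lambda>n. d (fixed_point X (T n)) (fixed_point X T0)) \<longlonglongrightarrow> 0"
    by (rule fixed_points_tendsto[OF assms(3-5) fp0(1) _ fp])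
  then have "converges_to X d (\<lambda>n. fixed_point X (T n)) (fixed_point X T0)"
    using fp(1) fp0(1) by (auto simp: converges_to_def)
  with ex ex0 show ?thesis by blast
qed

end
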